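(* Let $N\ge 2$, $\alpha,\beta>0$, $L=\frac{N-1}{\beta}$, let $\mathbf{e}\in\mathbb{R}_+^{N(N-1)/2}$ be the vector of pairwise squared nodal distances, $\mathbf{S}\in\{0,1\}^{N\times N(N-1)/2}$ the edge-to-degree map, and $F,G$ the functions on $\mathbb{R}^N$ defined in the context. Consider the iterations, initialized with $\boldsymbol\omega_1=\boldsymbol\lambda_0\in\mathbb{R}^N$ and $t_1=1$, for $k=1,2,\ldots$, $$\boldsymbol\lambda_k=\mathbf{prox}_{L^{-1}G}\Big(\boldsymbol\omega_k-\tfrac1L\nabla F(\boldsymbol\omega_k)\Big),\quad t_{k+1}=\tfrac{1+\sqrt{1+4t_k^2}}{2},\quad \boldsymbol\omega_{k+1}=\boldsymbol\lambda_k+\Big(\tfrac{t_k-1}{t_{k+1}}\Big)(\boldsymbol\lambda_k-\boldsymbol\lambda_{k-1}).$$ Then for every $k\ge1$ the update of $\boldsymbol\lambda_k$ can be equivalently rewritten as $$\boldsymbol\lambda_k=\boldsymbol\omega_k-L^{-1}(\mathbf{S}\bar{\mathbf{w}}_k-\mathbf{u}_k),$$ with $$\bar{\mathbf{w}}_k=\max\Big(\mathbf{0},\frac{\mathbf{S}^\top\boldsymbol\omega_k-2\mathbf{e}}{2\beta}\Big),\qquad \mathbf{u}_k=\frac{\mathbf{S}\bar{\mathbf{w}}_k-L\boldsymbol\omega_k+\sqrt{(\mathbf{S}\bar{\mathbf{w}}_k-L\boldsymbol\omega_k)^2+4\alpha L\mathbf{1}}}{2},$$ where $\max(\cdot,\cdot)$,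 $(\cdot)^2$ and $\sqrt{\cdot}$ are element-wise operations on their vector arguments.
   Context: Coordinates of vectors $\mathbf{w}\in\mathbb{R}^{N(N-1)/2}$ are indexed by unordered pairs $\{i,j\}$, $1\le i<j\le N$ (the upper-triangular entries of a symmetric hollow matrix $\mathbf{W}$). Given data vectors $\bar{\mathbf{x}}_1,\ldots,\bar{\mathbf{x}}_N\in\mathbb{R}^P$, $\mathbf{e}$ has entries $e_{\{i,j\}}=\|\bar{\mathbf{x}}_i-\bar{\mathbf{x}}_j\|_2^2$. The matrix $\mathbf{S}$ maps edge weights to nodal degrees: $(\mathbf{S}\mathbf{w})_i=\sum_{j\ne i}w_{\{i,j\}}$. $f(\mathbf{w})=\mathbb{I}\{\mathbf{w}\succeq\mathbf{0}\}+2\mathbf{w}^\top\mathbf{e}+\beta\|\mathbf{w}\|_2^2$, where $\mathbb{I}\{\mathbf{w}\succeq\mathbf{0}\}=0$ if all entries of $\mathbf{w}$ are nonnegative and $+\infty$ otherwise. $g(\mathbf{d})=-\alpha\sum_{i=1}^N\log d_i$ for $\mathbf{d}\in\mathbb{R}^N$ with all entries positive, and $g(\mathbf{d})=+\infty$ otherwise. For $\boldsymbol\lambda\in\mathbb{R}^N$: $F(\boldsymbol\lambda)=\max_{\mathbf{w}}\{\langle\mathbf{S}^\top\boldsymbol\lambda,\mathbf{w}\rangle-f(\mathbf{w})\}$ (a differentiable function) and $G(\boldsymbol\lambda)=\sup_{\mathbf{d}}\{\langle-\boldsymbol\lambda,\mathbf{d}\rangle-g(\mathbf{d})\}$ (possibly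 $+\infty$). The proximal operator of a proper, lower semicontinuous convex function $h$ is $\mathbf{prox}_h(\mathbf{x})=\operatorname*{argmin}_{\mathbf{u}}\{h(\mathbf{u})+\frac12\|\mathbf{u}-\mathbf{x}\|_2^2\}$. $\mathbf{1}$ is the all-ones vector. *)

theory Defs
  imports "HOL-Analysis.Analysis"
begin

text \<open>
  Nodes are the elements of a type \<open>'n\<close> of class \<^class>\<open>card2\<close>, i.e. finite with at least two elements,
  so that \<open>N = CARD('n) \<ge> 2\<close>. Vectors of edge weights are indexed by the unordered pairs of
  distinct nodes.
\<close>

typedef ('n::card2) edge = "{E :: 'n set. card E = 2}"
proof -
  obtain E :: "'n set" where "card E = 2"
    using obtain_subset_with_card_n[OF two_le_card[where 'a = 'n]] by auto
  then show ?thesis by auto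
qed

instance edge :: (card2) finite
proof
  have "inj (Rep_edge :: 'a edge \<Rightarrow> 'a set)"
    by (simp add: inj_def Rep_edge_inject)
  moreover have "finite (range (Rep_edge :: 'a edge \<Rightarrow> 'a set))"
    by (rule finite_subset[OF subset_UNIV]) simp
  ultimately show "finite (UNIV :: 'a edge set)"
    by (rule finite_imageD[rotated])
qed

text \<open>\<open>edge i j\<close> is the index \<open>{i, j}\<close>; it is meaningful only for \<open>i \<noteq> j\<close>.\<close>

definition edge :: "'n::card2 \<Rightarrow> 'n \<Rightarrow> 'n edge" where
  "edge i j = Abs_edge {i, j}"

lemma Rep_edge_edge: "i \<noteq> j \<Longrightarrow> Rep_edge (edge i j) = {i, j}"
  by (simp add: edge_def Abs_edge_inverse)

lemma edge_cases:
  obtains i j where "i \<noteq> j" "E = edge i j"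
proof -
  have "card (Rep_edge E) = 2" using Rep_edge[of E] by simp
  then obtain i j where "i \<noteq> j" "Rep_edge E = {i, j}" by (auto simp: card_2_iff)
  then show thesis using that by (metis Rep_edge_edge Rep_edge_inject)
qed

definition sq_dist_vec :: "('n::card2 \<Rightarrow> real ^ 'p) \<Rightarrow> real ^ ('n edge)" where
  "sq_dist_vec x = (\<chi> E. THE r. \<exists>i j. Rep_edge E = {i, j} \<and> r = (norm (x i - x j))\<^sup>2)"

lemma sq_dist_vec_edge:
  assumes "i \<noteq> j"
  shows "sq_dist_vec x $ edge i j = (norm (x i - x j))\<^sup>2"
proof -
  have "(THE r. \<exists>i' j'. {i, j} = {i', j'} \<and> r = (norm (x i' - x j'))\<^sup>2) = (norm (x i - x j))\<^sup>2"
    by (rule the_equality) (auto simp: doubleton_eq_iff norm_minus_commute)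
  then show ?thesis using assms by (simp add: sq_dist_vec_def Rep_edge_edge)
qed

definition degree_mat :: "real ^ ('n edge) ^ ('n::card2)" where
  "degree_mat = (\<chi> i E. of_bool (i \<in> Rep_edge E))"

lemma degree_mat_mult:
  fixes w :: "real ^ ('n::card2 edge)"
  shows "(degree_mat *v w) $ i = (\<Sum>j\<in>UNIV - {i}. w $ edge i j)"
proof -
  have inj: "inj_on (edge i) (UNIV - {i})"
    by (rule inj_onI) (metis DiffD2 Rep_edge_edge doubleton_eq_iff insertI1)
  have img: "{E. i \<in> Rep_edge E} = edge i ` (UNIV - {i})"
  proof (intro set_eqI iffI)
    fix E assume "E \<in> {E. i \<in> Rep_edge E}"
    then have i: "i \<in> Rep_edge E" by simp
    obtain a b where "a \<noteq> b" "E = edge a b" by (rule edge_cases)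
    show "E \<in> edge i ` (UNIV - {i})"
    proof -
      have "edge a b = edge b a" by (simp add: edge_def insert_commute)
      moreover have "i = a \<or> i = b" using i \<open>a \<noteq> b\<close> \<open>E = edge a b\<close> by (simp add: Rep_edge_edge)
      ultimately show ?thesis using \<open>a \<noteq> b\<close> \<open>E = edge a b\<close> by (metis Diff_iff UNIV_I imageI singletonD)
    qed
  next
    fix E assume "E \<in> edge i ` (UNIV - {i})"
    then obtain j where "i \<noteq> j" "E = edge i j" by (metis Diff_iff imageE singletonI)
    then show "E \<in> {E. i \<in> Rep_edge E}" by (simp add: Rep_edge_edge)
  qed
  have "(degree_mat *v w) $ i = (\<Sum>E\<in>{E. i \<in> Rep_edge E}. w $ E)"
    by (simp add: matrix_vector_mult_def degree_mat_def sum.If_cases of_bool_def if_distrib[of "\<lambda>x. x * _"] cong: if_cong)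
  also have "\<dots> = (\<Sum>j\<in>UNIV - {i}. w $ edge i j)"
    unfolding img by (simp add: sum.reindex[OF inj])
  finally show ?thesis .
qed

definition primal_f :: "real \<Rightarrow> real ^ ('n::card2 edge) \<Rightarrow> real ^ ('n edge) \<Rightarrow> ereal" where
  "primal_f \<beta> e w =
     (if \<forall>E. 0 \<le> w $ E then 0 else \<infinity>) + ereal (2 * (w \<bullet> e) + \<beta> * (norm w)\<^sup>2)"

definition primal_g :: "real \<Rightarrow> real ^ 'n \<Rightarrow> ereal" where
  "primal_g \<alpha> d = (if \<forall>i. 0 < d $ i then ereal (- \<alpha> * (\<Sum>i\<in>UNIV. ln (d $ i))) else \<infinity>)"

text \<open>A maximum, not just a supremum: \<open>Greatest\<close> selects the largest attained value.\<close>

definition dual_F :: "real \<Rightarrow> real ^ ('n::card2 edge) \<Rightarrow> real ^ 'n::card2 \<Rightarrow> real" where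
  "dual_F \<beta> e l = real_of_ereal
     (GREATEST v. \<exists>w. v = ereal ((transpose degree_mat *v l) \<bullet> w) - primal_f \<beta> e w)"

definition dual_G :: "real \<Rightarrow> real ^ 'n \<Rightarrow> ereal" where
  "dual_G \<alpha> l = (SUP d. ereal ((- l) \<bullet> d) - primal_g \<alpha> d)"

definition gradient :: "('a::real_inner \<Rightarrow> real) \<Rightarrow> 'a \<Rightarrow> 'a" where
  "gradient h x = (THE v. GDERIV h x :> v)"

definition prox :: "('a::real_inner \<Rightarrow> ereal) \<Rightarrow> 'a \<Rightarrow> 'a" where
  "prox h x = (ARG_MIN (\<lambda>u. h u + ereal (1 / 2 * (norm (u - x))\<^sup>2)) u. True)"

end

theory Submission imports Defs
begin

text \<open>
  Both conjugates separate over coordinates. The maximizer defining \<open>F\<close> is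
  \<open>max 0 ((S\<^sup>T \<lambda> - 2 e) / (2 \<beta>))\<close>, and the gradient of \<open>F\<close> is its image under \<open>S\<close>. The function \<open>G\<close> is,
  up to a constant, the logarithmic barrier \<open>- \<alpha> \<Sum> ln \<lambda>\<^sub>i\<close> of the positive orthant, so its proximal
  point at \<open>y\<close> is the positive root \<open>p\<close> of \<open>p\<^sup>2 - y\<^sub>i p = \<alpha> / L\<close> in each coordinate.
\<close>

section \<open>Closed form of the conjugate \<open>dual_F\<close>\<close>

lemma quadratic_le_pos_part:
  fixes b c w :: real
  assumes "b > 0" "w \<ge> 0"
  shows "c * w - b * w\<^sup>2 \<le> (max 0 c)\<^sup>2 / (4 * b)"
proof -
  have "c * w \<le> max 0 c * w"
    using assms by (intro mult_right_mono) auto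
  \<comment> \<open>Completing the square around the vertex of the parabola.\<close>
  moreover have "max 0 c * w - b * w\<^sup>2 = (max 0 c)\<^sup>2 / (4 * b) - b * (w - max 0 c / (2 * b))\<^sup>2"
    using assms by (simp add: field_simps power2_eq_square)
  moreover have "b * (w - max 0 c / (2 * b))\<^sup>2 \<ge> 0"
    using assms by simp
  ultimately show ?thesis by linarith
qed

text \<open>The vertex clipped at 0 attains the preceding bound, so the supremum over
  \<open>w \<ge> 0\<close> is a maximum, as \<open>GREATEST\<close> requires.\<close>

lemma quadratic_at_pos_part:
  fixes b c :: real
  assumes "b > 0"
  shows "c * max 0 (c / (2 * b)) - b * (max 0 (c / (2 * b)))\<^sup>2 = (max 0 c)\<^sup>2 / (4 * b)"
proof (cases "c \<ge> 0")
  case True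
  then show ?thesis using assms by (simp add: field_simps power2_eq_square)
next
  case False
  then have "c / (2 * b) < 0" using assms by (simp add: field_simps)
  then show ?thesis using False by simp
qed

lemma power2_norm_vec: "(norm v)\<^sup>2 = (\<Sum>i\<in>UNIV. (v $ i)\<^sup>2)" for v :: "real ^ 'n"
  unfolding power2_norm_eq_inner by (simp add: inner_vec_def power2_eq_square)

lemma primal_f_objective:
  fixes a w e :: "real ^ ('n::card2 edge)"
  assumes "\<forall>E. 0 \<le> w $ E"
  shows "ereal (a \<bullet> w) - primal_f \<beta> e w = ereal (\<Sum>E\<in>UNIV. (a - 2 *\<^sub>R e) $ E * w $ E - \<beta> * (w $ E)\<^sup>2)"
proof -
  have "a \<bullet> w - (2 * (w \<bullet> e) + \<beta> * (norm w)\<^sup>2)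
      = (\<Sum>E\<in>UNIV. (a - 2 *\<^sub>R e) $ E * w $ E - \<beta> * (w $ E)\<^sup>2)"
    unfolding power2_norm_vec inner_vec_def sum_distrib_left sum.distrib[symmetric] sum_subtractf[symmetric]
    by (intro sum.cong) (simp_all add: algebra_simps)
  then show ?thesis using assms by (simp add: primal_f_def)
qed

lemma dual_F_eq:
  fixes l :: "real ^ ('n::card2)"
  assumes "\<beta> > 0"
  shows "dual_F \<beta> e l = (\<Sum>E\<in>UNIV. (max 0 ((transpose degree_mat *v l - 2 *\<^sub>R e) $ E))\<^sup>2 / (4 * \<beta>))"
    (is "_ = ?m")
proof -
  define a :: "real ^ ('n edge)" where "a = transpose degree_mat *v l"
  have "(GREATEST v. \<exists>w. v = ereal (a \<bullet> w) - primal_f \<beta> e w) = ereal ?m"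
  proof (rule Greatest_equality)
    \<comment> \<open>The objective is a sum of scalar quadratics, so clipping each vertex at 0
      maximizes every summand at once.\<close>
    define w :: "real ^ ('n edge)" where "w = (\<chi> E. max 0 ((a - 2 *\<^sub>R e) $ E / (2 * \<beta>)))"
    have "ereal (a \<bullet> w) - primal_f \<beta> e w = ereal (\<Sum>E\<in>UNIV. (a - 2 *\<^sub>R e) $ E * w $ E - \<beta> * (w $ E)\<^sup>2)"
      by (rule primal_f_objective) (simp add: w_def)
    also have "\<dots> = ereal ?m"
      unfolding w_def a_def
      using quadratic_at_pos_part[OF assms] by simp
    finally show "\<exists>w. ereal ?m = ereal (a \<bullet> w) - primal_f \<beta> e w" by metis
  next
    fix v assume "\<exists>w. v = ereal (a \<bullet> w) - primal_f \<beta> e w"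
    then obtain w where v: "v = ereal (a \<bullet> w) - primal_f \<beta> e w" by blast
    show "v \<le> ereal ?m"
    proof (cases "\<forall>E. 0 \<le> w $ E")
      case True
      then show ?thesis
        unfolding v primal_f_objective[OF True] a_def ereal_less_eq
        by (intro sum_mono quadratic_le_pos_part[OF assms]) simp
    next
      case False
      then have "v = - \<infinity>" unfolding v primal_f_def by simp
      then show ?thesis by simp
    qed
  qed
  then show ?thesis unfolding dual_F_def a_def[symmetric] by simp
qed

section \<open>The gradient of \<open>dual_F\<close>\<close>

text \<open>Squaring smooths the kink of \<open>max 0 s\<close> at 0: the linearization error is at
  most \<open>h\<^sup>2\<close> even when the step crosses 0, so the difference quotient is off by
  at most the absolute value of \<open>h\<close>.\<close>

lemma DERIV_pos_part_square: "((\<lambda>s. (max 0 s)\<^sup>2) has_real_derivative 2 * max 0 s) (at s)"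
proof -
  have bound: "\<bar>(max 0 (s + h))\<^sup>2 - (max 0 s)\<^sup>2 - 2 * max 0 s * h\<bar> \<le> h\<^sup>2" for h :: real
  proof -
    consider "s \<ge> 0" "s + h \<ge> 0" | "s \<ge> 0" "s + h \<le> 0" | "s \<le> 0" "s + h \<ge> 0" | "s \<le> 0" "s + h \<le> 0"
      by linarith
    then show ?thesis
    proof cases
      case 1
      then show ?thesis by (simp add: power2_eq_square algebra_simps)
    next
      case 2
      \<comment> \<open>The error here is \<open>- s * (s + 2 * h)\<close>, nonnegative because
        \<open>s + 2 * h \<le> 0\<close>. It equals \<open>h\<^sup>2 - (s + h)\<^sup>2\<close>,
        which gives the upper bound.\<close>
      have "s\<^sup>2 + 2 * s * h \<le> 0"
        using 2 mult_left_mono[of "s + 2 * h" 0 s] by (simp add: power2_eq_square algebra_simps)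
      moreover have "h\<^sup>2 + s\<^sup>2 + 2 * s * h = (s + h)\<^sup>2"
        by (simp add: power2_eq_square algebra_simps)
      ultimately have "\<bar>- s\<^sup>2 - 2 * s * h\<bar> \<le> h\<^sup>2"
        using zero_le_power2[of "s + h"] zero_le_power2[of h] by linarith
      then show ?thesis using 2 by simp
    next
      case 3
      then have "(s + h)\<^sup>2 \<le> h\<^sup>2" by (intro power_mono) auto
      then show ?thesis using 3 by simp
    next
      case 4
      then show ?thesis by simp
    qed
  qed
  have "((\<lambda>h. ((max 0 (s + h))\<^sup>2 - (max 0 s)\<^sup>2) / h - 2 * max 0 s) \<longlongrightarrow> 0) (at 0)"
  proof (rule Lim_null_comparison)
    show "\<forall>\<^sub>F h in at 0. norm (((max 0 (s + h))\<^sup>2 - (max 0 s)\<^sup>2) / h - 2 * max 0 s) \<le> \<bar>h\<bar>"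
    proof (rule eventually_at_filter[THEN iffD2, OF always_eventually], intro allI impI)
      fix h :: real assume "h \<noteq> 0"
      then have "((max 0 (s + h))\<^sup>2 - (max 0 s)\<^sup>2) / h - 2 * max 0 s
          = ((max 0 (s + h))\<^sup>2 - (max 0 s)\<^sup>2 - 2 * max 0 s * h) / h"
        by (simp add: field_simps)
      then have "norm (((max 0 (s + h))\<^sup>2 - (max 0 s)\<^sup>2) / h - 2 * max 0 s)
          = \<bar>(max 0 (s + h))\<^sup>2 - (max 0 s)\<^sup>2 - 2 * max 0 s * h\<bar> / \<bar>h\<bar>"
        by simp
      also have "\<dots> \<le> h\<^sup>2 / \<bar>h\<bar>"
        by (intro divide_right_mono bound) simp
      also have "\<dots> = \<bar>h\<bar>"
        using \<open>h \<noteq> 0\<close> by (simp add: power2_eq_square divide_simps)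
      finally show "norm (((max 0 (s + h))\<^sup>2 - (max 0 s)\<^sup>2) / h - 2 * max 0 s) \<le> \<bar>h\<bar>" .
    qed
    show "((\<lambda>h::real. \<bar>h\<bar>) \<longlongrightarrow> 0) (at 0)"
      by (rule tendsto_rabs_zero) simp
  qed
  then show ?thesis unfolding DERIV_def by (rule LIM_zero_cancel)
qed

text \<open>Derivatives are unique and a vector is determined by its inner products, so the
  \<open>THE\<close> in \<open>gradient\<close> is well defined.\<close>

lemma gradient_eqI:
  assumes "GDERIV h x :> v"
  shows "gradient h x = v"
  unfolding gradient_def
proof (rule the_equality)
  show "GDERIV h x :> v" by (rule assms)
next
  fix v' assume "GDERIV h x :> v'"
  then have "(\<lambda>d. d \<bullet> v') = (\<lambda>d. d \<bullet> v)"
    using assms unfolding gderiv_def by (rule has_derivative_unique)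
  then show "v' = v" by (metis inner_commute vector_eq_rdot)
qed

lemma GDERIV_dual_F:
  fixes l :: "real ^ ('n::card2)"
  assumes "\<beta> > 0"
  shows "GDERIV (dual_F \<beta> e) l :>
    degree_mat *v (\<chi> E. max 0 ((transpose degree_mat *v l - 2 *\<^sub>R e) $ E / (2 * \<beta>)))"
    (is "GDERIV _ _ :> degree_mat *v ?w")
proof -
  define c where "c = (\<lambda>(l::real ^ ('n::card2)) E. (transpose degree_mat *v l - 2 *\<^sub>R e) $ E)"
  have c: "((\<lambda>l. c l E) has_derivative (\<lambda>h. (transpose degree_mat *v h) $ E)) (at l)" for E
  proof -
    have "bounded_linear (\<lambda>h::real ^ ('n::card2). (transpose degree_mat *v h) $ E)"
      by (intro bounded_linear_compose[OF bounded_linear_vec_nth] matrix_vector_mul_bounded_linear)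
    then show ?thesis
      unfolding c_def vector_minus_component
      by (intro has_derivative_eq_rhs[OF has_derivative_diff[OF bounded_linear_imp_has_derivative has_derivative_const]])
        auto
  qed
  have "((\<lambda>l. (max 0 (c l E))\<^sup>2) has_derivative (\<lambda>h. 2 * max 0 (c l E) * (transpose degree_mat *v h) $ E)) (at l)" for E
    using has_derivative_compose[OF c DERIV_pos_part_square[unfolded has_field_derivative_def]] .
  then have "((\<lambda>l. \<Sum>E\<in>UNIV. (max 0 (c l E))\<^sup>2 * (1 / (4 * \<beta>))) has_derivative
      (\<lambda>h. \<Sum>E\<in>UNIV. 2 * max 0 (c l E) * (transpose degree_mat *v h) $ E * (1 / (4 * \<beta>)))) (at l)"
    by (intro has_derivative_sum has_derivative_mult_left)
  \<comment> \<open>The constants combine to \<open>1 / (2 * \<beta>)\<close>, which moves inside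
    the maximum since \<beta> > 0. Adjointness then moves the transpose off
    \<open>h\<close>.\<close>
  moreover have "(\<Sum>E\<in>UNIV. 2 * max 0 (c l E) * (transpose degree_mat *v h) $ E * (1 / (4 * \<beta>)))
      = h \<bullet> (degree_mat *v ?w)" for h
  proof -
    have "max 0 (s / (2 * \<beta>)) = max 0 s / (2 * \<beta>)" for s
      using assms by (simp add: max_def divide_simps)
    then have "(\<Sum>E\<in>UNIV. 2 * max 0 (c l E) * (transpose degree_mat *v h) $ E * (1 / (4 * \<beta>)))
        = (transpose degree_mat *v h) \<bullet> ?w"
      unfolding inner_vec_def c_def by (intro sum.cong) (simp_all add: field_simps)
    then show ?thesis by (simp add: dot_lmul_matrix)
  qed
  moreover have "dual_F \<beta> e = (\<lambda>l. \<Sum>E\<in>UNIV. (max 0 (c l E))\<^sup>2 * (1 / (4 * \<beta>)))"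
    by (intro ext) (simp add: c_def dual_F_eq[OF assms])
  ultimately show ?thesis unfolding gderiv_def by simp
qed

section \<open>The conjugate \<open>dual_G\<close> as a logarithmic barrier\<close>

text \<open>This is the tangent bound \<open>ln z \<le> z - 1\<close> at
  \<open>z = d / (a / l)\<close>, an equality at \<open>d = a / l\<close>.\<close>

lemma ln_minus_linear_le:
  fixes a l d :: real
  assumes "a > 0" "l > 0" "d > 0"
  shows "a * ln d - l * d \<le> a * ln (a / l) - a"
proof -
  have "ln (d / (a / l)) \<le> d / (a / l) - 1"
    using assms by (intro ln_le_minus_one) simp
  then have "ln d - ln (a / l) \<le> d * l / a - 1"
    using assms by (subst (asm) ln_div) auto
  then have "a * (ln d - ln (a / l)) \<le> a * (d * l / a - 1)"
    using assms by (intro mult_left_mono) auto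
  then show ?thesis using assms by (simp add: algebra_simps)
qed

lemma primal_g_objective:
  fixes l d :: "real ^ 'n"
  assumes "\<forall>i. 0 < d $ i"
  shows "ereal ((- l) \<bullet> d) - primal_g \<alpha> d = ereal (\<Sum>i\<in>UNIV. \<alpha> * ln (d $ i) - l $ i * d $ i)"
proof -
  have "(- l) \<bullet> d = - (\<Sum>i\<in>UNIV. l $ i * d $ i)"
    unfolding inner_minus_left by (simp add: inner_vec_def)
  moreover have "(\<Sum>i\<in>UNIV. \<alpha> * ln (d $ i) - l $ i * d $ i)
      = \<alpha> * (\<Sum>i\<in>UNIV. ln (d $ i)) - (\<Sum>i\<in>UNIV. l $ i * d $ i)"
    unfolding sum_subtractf sum_distrib_left ..
  ultimately show ?thesis using assms unfolding primal_g_def by simp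
qed

lemma dual_G_pos:
  fixes l :: "real ^ 'n"
  assumes "\<alpha> > 0" "\<forall>i. 0 < l $ i"
  shows "dual_G \<alpha> l = ereal (\<Sum>i\<in>UNIV. \<alpha> * ln (\<alpha> / l $ i) - \<alpha>)" (is "_ = ?m")
  unfolding dual_G_def
proof (rule antisym)
  show "(SUP d. ereal ((- l) \<bullet> d) - primal_g \<alpha> d) \<le> ?m"
  proof (rule SUP_least)
    fix d
    show "ereal ((- l) \<bullet> d) - primal_g \<alpha> d \<le> ?m"
    proof (cases "\<forall>i. 0 < d $ i")
      case True
      then show ?thesis
        unfolding primal_g_objective[OF True] ereal_less_eq
        using assms by (intro sum_mono ln_minus_linear_le) auto
    next
      case False
      then have "primal_g \<alpha> d = \<infinity>" unfolding primal_g_def by (rule if_not_P)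
      then show ?thesis by simp
    qed
  qed
  \<comment> \<open>The equality case of the tangent bound in every coordinate.\<close>
  define d :: "real ^ 'n" where "d = (\<chi> i. \<alpha> / l $ i)"
  have d: "?m = ereal ((- l) \<bullet> d) - primal_g \<alpha> d"
    by (subst primal_g_objective)
      (use assms in \<open>auto simp: d_def less_imp_neq[THEN not_sym] intro!: sum.cong\<close>)
  show "?m \<le> (SUP d. ereal ((- l) \<bullet> d) - primal_g \<alpha> d)"
    unfolding d by (rule SUP_upper) simp
qed

text \<open>Letting the single entry \<open>d $ j\<close> grow makes the logarithm unbounded, while
  the linear term \<open>- l $ j * d $ j\<close> stays nonnegative.\<close>

lemma dual_G_not_pos:
  fixes l :: "real ^ 'n"
  assumes "\<alpha> > 0" "l $ j \<le> 0"
  shows "dual_G \<alpha> l = \<infinity>"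
  unfolding dual_G_def
proof (rule SUP_PInfty)
  fix n :: nat
  define c where "c = (\<Sum>i\<in>UNIV - {j}. l $ i)"
  \<comment> \<open>Chosen so that \<open>\<alpha> * ln r = n + c\<close>: the \<open>c\<close>
    offsets the other coordinates, which are set to 1 and contribute \<open>- c\<close>.\<close>
  define r where "r = exp ((real n + c) / \<alpha>)"
  define d :: "real ^ 'n" where "d = (\<chi> i. if i = j then r else 1)"
  have "r > 0" by (simp add: r_def)
  have "(\<Sum>i\<in>UNIV. \<alpha> * ln (d $ i) - l $ i * d $ i) = (\<alpha> * ln r - l $ j * r) - c"
    by (subst sum.remove[of _ j]) (auto simp: d_def c_def sum_negf[symmetric] intro!: sum.cong)
  also have "\<dots> = real n - l $ j * r"
    using assms by (simp add: r_def)
  finally have "ereal ((- l) \<bullet> d) - primal_g \<alpha> d = ereal (real n - l $ j * r)"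
    using \<open>r > 0\<close> by (subst primal_g_objective) (auto simp: d_def)
  moreover have "l $ j * r \<le> 0"
    using assms \<open>r > 0\<close> by (simp add: mult_nonpos_nonneg)
  ultimately show "\<exists>d\<in>UNIV. ereal (real n) \<le> ereal ((- l) \<bullet> d) - primal_g \<alpha> d"
    by (intro bexI[of _ d]) auto
qed

section \<open>The proximal point of \<open>dual_G\<close>\<close>

text \<open>\<open>ARG_MIN\<close> picks an arbitrary minimizer, so strictness is what pins its
  value down to \<open>p\<close>.\<close>

lemma prox_eqI:
  assumes "\<And>u. u \<noteq> p \<Longrightarrow>
    h p + ereal (1 / 2 * (norm (p - y))\<^sup>2) < h u + ereal (1 / 2 * (norm (u - y))\<^sup>2)"
  shows "prox h y = p"
  unfolding prox_def arg_min_def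
proof (rule some_equality)
  show "is_arg_min (\<lambda>u. h u + ereal (1 / 2 * (norm (u - y))\<^sup>2)) (\<lambda>_. True) p"
    unfolding is_arg_min_def using assms by (metis less_asym less_irrefl)
next
  fix u assume "is_arg_min (\<lambda>u. h u + ereal (1 / 2 * (norm (u - y))\<^sup>2)) (\<lambda>_. True) u"
  then show "u = p" unfolding is_arg_min_def using assms by metis
qed

text \<open>The hypothesis \<open>root\<close> is the stationarity condition
  \<open>- c / p + (p - y) = 0\<close>. Convexity of \<open>- c * ln u\<close> then leaves the full
  quadratic gap \<open>1 / 2 * (u - p)\<^sup>2\<close>, which makes the minimizer unique.\<close>

lemma log_barrier_prox_gap:
  fixes c p u y :: real
  assumes "c > 0" "p > 0" "u > 0" and root: "p * (p - y) = c"
  shows "- c * ln p + 1 / 2 * (p - y)\<^sup>2 + 1 / 2 * (u - p)\<^sup>2 \<le> - c * ln u + 1 / 2 * (u - y)\<^sup>2"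
proof -
  have "ln (u / p) \<le> u / p - 1"
    using assms by (intro ln_le_minus_one) simp
  then have "c * (ln u - ln p) \<le> c * (u / p - 1)"
    using assms by (intro mult_left_mono) (auto simp: ln_div)
  also have "\<dots> = (u - p) * (p - y)"
    unfolding root[symmetric] using \<open>p > 0\<close> by (simp add: field_simps)
  \<comment> \<open>The expansion of \<open>(u - y)\<^sup>2\<close> with
    \<open>u - y = (u - p) + (p - y)\<close>.\<close>
  also have "\<dots> = 1 / 2 * (u - y)\<^sup>2 - 1 / 2 * (p - y)\<^sup>2 - 1 / 2 * (u - p)\<^sup>2"
    by (simp add: power2_eq_square algebra_simps)
  finally show ?thesis by (simp add: algebra_simps)
qed

text \<open>On the positive orthant the objective is a constant plus a sum of scalar barrier
  problems, for which the hypotheses on \<open>p\<close> are stationarity. Elsewhere it is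
  infinite.\<close>

lemma prox_dual_G:
  fixes p y :: "real ^ 'n"
  assumes "\<alpha> > 0" "L > 0" and pos: "\<And>i. p $ i > 0"
    and root: "\<And>i. p $ i * (p $ i - y $ i) = \<alpha> / L"
  shows "prox (\<lambda>l. ereal (1 / L) * dual_G \<alpha> l) y = p"
proof (rule prox_eqI)
  define \<phi> where "\<phi> = (\<lambda>u :: real ^ 'n. \<Sum>i\<in>UNIV. - (\<alpha> / L) * ln (u $ i) + 1 / 2 * (u $ i - y $ i)\<^sup>2)"
  \<comment> \<open>The part of the scaled \<open>dual_G\<close> that does not depend on its
    argument.\<close>
  define K where "K = (\<Sum>i\<in>(UNIV :: 'n set). 1 / L * (\<alpha> * ln \<alpha> - \<alpha>))"
  have obj: "ereal (1 / L) * dual_G \<alpha> u + ereal (1 / 2 * (norm (u - y))\<^sup>2) = ereal (K + \<phi> u)"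
    if u: "\<forall>i. u $ i > 0" for u
  proof -
    have "1 / L * (\<Sum>i\<in>UNIV. \<alpha> * ln (\<alpha> / u $ i) - \<alpha>) + 1 / 2 * (norm (u - y))\<^sup>2 = K + \<phi> u"
      unfolding power2_norm_vec K_def \<phi>_def sum_distrib_left sum.distrib[symmetric]
    proof (intro sum.cong refl)
      fix i
      have "ln (\<alpha> / u $ i) = ln \<alpha> - ln (u $ i)"
        using assms(1) u[rule_format, of i] by (simp add: ln_div)
      then show "1 / L * (\<alpha> * ln (\<alpha> / u $ i) - \<alpha>) + 1 / 2 * ((u - y) $ i)\<^sup>2
          = 1 / L * (\<alpha> * ln \<alpha> - \<alpha>) + (- (\<alpha> / L) * ln (u $ i) + 1 / 2 * (u $ i - y $ i)\<^sup>2)"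
        by (simp add: right_diff_distrib diff_divide_distrib)
    qed
    then show ?thesis by (simp add: dual_G_pos[OF assms(1) u])
  qed
  fix u assume "u \<noteq> p"
  show "ereal (1 / L) * dual_G \<alpha> p + ereal (1 / 2 * (norm (p - y))\<^sup>2)
      < ereal (1 / L) * dual_G \<alpha> u + ereal (1 / 2 * (norm (u - y))\<^sup>2)"
  proof (cases "\<forall>i. u $ i > 0")
    case True
    \<comment> \<open>The scalar gaps add up to the squared distance, positive for
      \<open>u \<noteq> p\<close>.\<close>
    have "\<phi> p + 1 / 2 * (norm (u - p))\<^sup>2 \<le> \<phi> u"
      unfolding power2_norm_vec \<phi>_def sum_distrib_left sum.distrib[symmetric] vector_minus_component
      using assms True by (intro sum_mono log_barrier_prox_gap) auto
    moreover have "(norm (u - p))\<^sup>2 > 0" using \<open>u \<noteq> p\<close> by simp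
    ultimately have "\<phi> p < \<phi> u" by linarith
    then show ?thesis using obj[OF True] obj[of p] pos by simp
  next
    case False
    then obtain j where "u $ j \<le> 0" by (auto simp: not_less)
    then have "ereal (1 / L) * dual_G \<alpha> u = \<infinity>"
      using dual_G_not_pos[OF assms(1)] assms(2) by simp
    then have "ereal (1 / L) * dual_G \<alpha> u + ereal (1 / 2 * (norm (u - y))\<^sup>2) = \<infinity>"
      by (simp only: plus_ereal.simps)
    moreover have "ereal (1 / L) * dual_G \<alpha> p + ereal (1 / 2 * (norm (p - y))\<^sup>2) = ereal (K + \<phi> p)"
      using obj pos by blast
    ultimately show ?thesis by (simp only: less_ereal.simps)
  qed
qed

text \<open>The square root exceeds the absolute value of \<open>v\<close>, hence positivity. Since
  \<open>p + v / L\<close> has numerator \<open>v\<close> plus the same root, the product is a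
  difference of squares, leaving \<open>4 * a * L / (4 * L\<^sup>2)\<close>.\<close>

lemma quadratic_pos_root:
  fixes a L v :: real
  assumes "a > 0" "L > 0"
  defines "p \<equiv> (- v + sqrt (v\<^sup>2 + 4 * a * L)) / (2 * L)"
  shows "p > 0" "p * (p + v / L) = a / L"
proof -
  have "sqrt (v\<^sup>2 + 4 * a * L) > sqrt (v\<^sup>2)"
    using assms by (intro real_sqrt_less_mono) simp
  then have "sqrt (v\<^sup>2 + 4 * a * L) > \<bar>v\<bar>" by simp
  then show "p > 0" unfolding p_def using assms by simp
  have "(sqrt (v\<^sup>2 + 4 * a * L))\<^sup>2 = v\<^sup>2 + 4 * a * L"
    using assms by simp
  moreover have "p * (p + v / L) = ((sqrt (v\<^sup>2 + 4 * a * L))\<^sup>2 - v\<^sup>2) / (4 * L\<^sup>2)"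
    unfolding p_def using assms by (simp add: field_simps power2_eq_square)
  ultimately show "p * (p + v / L) = a / L"
    using assms by (simp add: power2_eq_square)
qed

section \<open>Equivalence of the two update rules\<close>

theorem proposition1:
  fixes x :: "'n::card2 \<Rightarrow> real ^ 'p"
    and \<alpha> \<beta> L :: real
    and e :: "real ^ ('n edge)"
    and S :: "real ^ ('n edge) ^ ('n::card2)"
    and lam om :: "nat \<Rightarrow> real ^ ('n::card2)"
    and t :: "nat \<Rightarrow> real"
  assumes "\<alpha> > 0" and "\<beta> > 0"
    and "L = (real CARD('n) - 1) / \<beta>"
    and "e = sq_dist_vec x"
    and "S = degree_mat"
    and "om 1 = lam 0" and "t 1 = 1"
    and "\<And>k. k \<ge> 1 \<Longrightarrow> t (k + 1) = (1 + sqrt (1 + 4 * (t k)\<^sup>2)) / 2"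
    and "\<And>k. k \<ge> 1 \<Longrightarrow>
           om (k + 1) = lam k + ((t k - 1) / t (k + 1)) *\<^sub>R (lam k - lam (k - 1))"
  shows "\<forall>k\<ge>1.
    lam k = prox (\<lambda>l. ereal (1 / L) * dual_G \<alpha> l)
                 (om k - (1 / L) *\<^sub>R gradient (dual_F \<beta> e) (om k))
    \<longleftrightarrow>
    (let wbar = (\<chi> E. max 0 ((transpose S *v om k - 2 *\<^sub>R e) $ E / (2 * \<beta>)));
         v = S *v wbar - L *\<^sub>R om k;
         u = (\<chi> i. (v $ i + sqrt ((v $ i)\<^sup>2 + 4 * \<alpha> * L)) / 2)
     in lam k = om k - (1 / L) *\<^sub>R (S *v wbar - u))"
proof (intro allI impI)
  fix k :: nat
  have "L > 0" using assms(2,3) two_le_card[where 'a = 'n] by simp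
  define w where "w = (\<chi> E. max 0 ((transpose S *v om k - 2 *\<^sub>R e) $ E / (2 * \<beta>)))"
  define v where "v = S *v w - L *\<^sub>R om k"
  define u where "u = (\<chi> i. (v $ i + sqrt ((v $ i)\<^sup>2 + 4 * \<alpha> * L)) / 2)"
  define p where "p = om k - (1 / L) *\<^sub>R (S *v w - u)"
  have grad: "gradient (dual_F \<beta> e) (om k) = S *v w"
    unfolding w_def \<open>S = degree_mat\<close> by (intro gradient_eqI GDERIV_dual_F \<open>\<beta> > 0\<close>)
  \<comment> \<open>Thus \<open>v\<close> is the gradient step rescaled by \<open>- L\<close>, which
    matches \<open>y = - v / L\<close> in the root equation.\<close>
  have y: "(om k - (1 / L) *\<^sub>R (S *v w)) $ i = - v $ i / L" for i
    using \<open>L > 0\<close> by (simp add: v_def field_simps)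
  \<comment> \<open>Adding \<open>u / L\<close> to \<open>- v / L\<close> flips the sign of
    \<open>v\<close> in the numerator and yields the positive root.\<close>
  have p: "p $ i = (- v $ i + sqrt ((v $ i)\<^sup>2 + 4 * \<alpha> * L)) / (2 * L)" for i
  proof -
    have "p $ i = - v $ i / L + u $ i / L"
      using y[of i] by (simp add: p_def algebra_simps)
    also have "\<dots> = (- v $ i + sqrt ((v $ i)\<^sup>2 + 4 * \<alpha> * L)) / (2 * L)"
      using \<open>L > 0\<close> by (simp add: u_def field_simps)
    finally show ?thesis .
  qed
  have "prox (\<lambda>l. ereal (1 / L) * dual_G \<alpha> l) (om k - (1 / L) *\<^sub>R (S *v w)) = p"
  proof (rule prox_dual_G[OF \<open>\<alpha> > 0\<close> \<open>L > 0\<close>])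
    fix i
    show "p $ i > 0"
      unfolding p by (rule quadratic_pos_root(1)[OF \<open>\<alpha> > 0\<close> \<open>L > 0\<close>])
    show "p $ i * (p $ i - (om k - (1 / L) *\<^sub>R (S *v w)) $ i) = \<alpha> / L"
      using quadratic_pos_root(2)[OF \<open>\<alpha> > 0\<close> \<open>L > 0\<close>, of "v $ i"] unfolding y p by simp
  qed
  \<comment> \<open>Both rules set \<open>lam k\<close> to the same vector \<open>p\<close>, so the
    two equations are equivalent.\<close>
  then show "lam k = prox (\<lambda>l. ereal (1 / L) * dual_G \<alpha> l)
                 (om k - (1 / L) *\<^sub>R gradient (dual_F \<beta> e) (om k))
    \<longleftrightarrow>
    (let wbar = (\<chi> E. max 0 ((transpose S *v om k - 2 *\<^sub>R e) $ E / (2 * \<beta>)));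
         v = S *v wbar - L *\<^sub>R om k;
         u = (\<chi> i. (v $ i + sqrt ((v $ i)\<^sup>2 + 4 * \<alpha> * L)) / 2)
     in lam k = om k - (1 / L) *\<^sub>R (S *v wbar - u))"
    unfolding grad Let_def p_def u_def v_def w_def by simp
qed

end
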